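(* Consider an $n$-qubit Clifford+$T$ circuit, a bipartition of its qubits into sides $A,B$ with $n_A$ and $n_B$ qubits ($n_A+n_B=n$) and local $T$-counts $T_A,T_B$, and let $d$ be the number of cross-cut gates. Cutting the circuit at depth one is beneficial in time over direct dense simulation if and only if $$d \;<\; \tfrac{n}{2}-\log_2\!\left[\min(2^{T_A},2^{n_A})+\min(2^{T_B},2^{n_B})\right]+\tfrac12\log_2(2^n),$$ which for balanced partitions and a dense-leaf choice at both halves simplifies to $d<n/2$.
   Context: A cross-cut gate is a two-qubit gate acting on one qubit of $A$ and one of $B$; each is a rank-2 gate, i.e. of the form $\sum_{\alpha\in\{0,1\}}U_A^{(\alpha)}\otimes U_B^{(\alpha)}$. Cutting at depth one means using a single bipartition and computing an amplitude as a sum over all $2^d$ choices of one term per cross-cut gate, each choice requiring one simulation of the $A$-circuit and one of the $B$-circuit (the two leaves). Cost model (common gate-count factor and polynomial factors ignored): direct dense (state-vector) simulation costs $2^n$; the depth-one cut costs $2^d(\ell_A+\ell_B)$ with leaf costs $\ell_A=\min(2^{T_A},2^{n_A})$ and $\ell_B=\min(2^{T_B},2^{n_B})$, the two terms in each minimum being the costs of a stabilizer-frame leaf and of a dense state-vector leaf. Balanced means $n_A=n_B=n/2$. A dense-leaf choice at both halves means that the leaf costs are $2^{n_A}$ and $2^{n_B}$. "Beneficial in time" means that the cost of the cut is strictly smaller than the cost of direct dense simulation.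
   Formalization: For balanced partitions with dense leaves, d<n/2 is false for the strict comparison (n=2, d=0: the cut costs 4=2^2); the displayed bound simplifies to d<n/2-1. The formal statement proves this, and d<n/2 only after dividing the cut cost by 2. *)

theory Defs
  imports "HOL-Analysis.Analysis"
begin

type_synonym mat1 = "complex^2^2"
type_synonym mat2 = "complex^(2 \<times> 2)^(2 \<times> 2)"

definition tensor :: "mat1 \<Rightarrow> mat1 \<Rightarrow> mat2" where
  "tensor U V = (\<chi> i j. U $ fst i $ fst j * V $ snd i $ snd j)"

definition adj :: "complex^'n^'n \<Rightarrow> complex^'n^'n" where
  "adj U = map_matrix cnj (transpose U)"

definition unitary :: "complex^'n^'n \<Rightarrow> bool" where
  "unitary U \<longleftrightarrow> U ** adj U = mat 1 \<and> adj U ** U = mat 1"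

definition paulis1 :: "mat1 set" where
  "paulis1 = {mat 1,
              vector [vector [0, 1], vector [1, 0]],
              vector [vector [0, - \<i>], vector [\<i>, 0]],
              vector [vector [1, 0], vector [0, - 1]]}"

definition paulis2 :: "mat2 set" where
  "paulis2 = {tensor P Q | P Q. P \<in> paulis1 \<and> Q \<in> paulis1}"

text \<open>Conjugation by a unitary maps a Hermitian matrix to a Hermitian one, so the only phases
  that can occur in front of a Pauli matrix are plus and minus one.\<close>

definition clifford :: "(complex^'n^'n) set \<Rightarrow> complex^'n^'n \<Rightarrow> bool" where
  "clifford Ps U \<longleftrightarrow> unitary U \<and>
     (\<forall>P\<in>Ps. \<exists>Q\<in>Ps. \<exists>s\<in>{1, - 1 :: real}. U ** P ** adj U = s *\<^sub>R Q)"

definition T_matrix :: mat1 where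
  "T_matrix = vector [vector [1, 0], vector [0, cis (pi / 4)]]"

definition is_T :: "mat1 \<Rightarrow> bool" where
  "is_T U \<longleftrightarrow> U = T_matrix \<or> U = adj T_matrix"

text \<open>In a two-qubit gate \<open>Gate2 U p q\<close> the first tensor factor of \<open>U\<close> acts on qubit \<open>p\<close> and the
  second one on qubit \<open>q\<close>.\<close>

datatype gate = Gate1 mat1 nat | Gate2 mat2 nat nat

type_synonym circuit = "gate list"

fun clifford_T_gate :: "nat \<Rightarrow> gate \<Rightarrow> bool" where
  "clifford_T_gate n (Gate1 U q) \<longleftrightarrow> q < n \<and> (clifford paulis1 U \<or> is_T U)"
| "clifford_T_gate n (Gate2 U p q) \<longleftrightarrow> p < n \<and> q < n \<and> p \<noteq> q \<and> clifford paulis2 U"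

definition clifford_T_circuit :: "nat \<Rightarrow> circuit \<Rightarrow> bool" where
  "clifford_T_circuit n C \<longleftrightarrow> (\<forall>g\<in>set C. clifford_T_gate n g)"

definition bipartition :: "nat \<Rightarrow> nat set \<Rightarrow> nat set \<Rightarrow> bool" where
  "bipartition n A B \<longleftrightarrow> A \<union> B = {..<n} \<and> A \<inter> B = {}"

fun T_gate_on :: "nat set \<Rightarrow> gate \<Rightarrow> bool" where
  "T_gate_on S (Gate1 U q) \<longleftrightarrow> q \<in> S \<and> is_T U"
| "T_gate_on S (Gate2 U p q) \<longleftrightarrow> False"

definition local_T_count :: "circuit \<Rightarrow> nat set \<Rightarrow> nat" where
  "local_T_count C S = length (filter (T_gate_on S) C)"

fun cross_cut :: "nat set \<Rightarrow> nat set \<Rightarrow> gate \<Rightarrow> bool" where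
  "cross_cut A B (Gate1 U q) \<longleftrightarrow> False"
| "cross_cut A B (Gate2 U p q) \<longleftrightarrow> p \<in> A \<and> q \<in> B \<or> p \<in> B \<and> q \<in> A"

definition cross_cut_positions :: "circuit \<Rightarrow> nat set \<Rightarrow> nat set \<Rightarrow> nat set" where
  "cross_cut_positions C A B = {i. i < length C \<and> cross_cut A B (C ! i)}"

fun rank_two :: "gate \<Rightarrow> bool" where
  "rank_two (Gate1 U q) \<longleftrightarrow> False"
| "rank_two (Gate2 U p q) \<longleftrightarrow>
     (\<exists>V W :: nat \<Rightarrow> mat1. U = (\<Sum>\<alpha>\<in>{0, 1}. tensor (V \<alpha>) (W \<alpha>)))"

definition cross_cuts_rank_two :: "circuit \<Rightarrow> nat set \<Rightarrow> nat set \<Rightarrow> bool" where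
  "cross_cuts_rank_two C A B \<longleftrightarrow> (\<forall>g\<in>set C. cross_cut A B g \<longrightarrow> rank_two g)"

text \<open>A branch of the cut selects one of the two terms of every cross-cut gate. An amplitude is a
  sum over all branches, and each branch runs one simulation of either side.\<close>

definition branches :: "circuit \<Rightarrow> nat set \<Rightarrow> nat set \<Rightarrow> (nat \<Rightarrow> nat) set" where
  "branches C A B = (\<Pi>\<^sub>E i\<in>cross_cut_positions C A B. {0, 1})"

definition cut_cost :: "circuit \<Rightarrow> nat set \<Rightarrow> nat set \<Rightarrow> real \<Rightarrow> real \<Rightarrow> real" where
  "cut_cost C A B lA lB = (\<Sum>b\<in>branches C A B. lA + lB)"

lemma cut_cost_eq:
  "cut_cost C A B lA lB = 2 ^ card (cross_cut_positions C A B) * (lA + lB)"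
  by (simp add: cut_cost_def branches_def cross_cut_positions_def card_PiE numeral_2_eq_2)

definition frame_leaf :: "circuit \<Rightarrow> nat set \<Rightarrow> real" where
  "frame_leaf C S = 2 ^ local_T_count C S"

definition dense_leaf :: "nat set \<Rightarrow> real" where
  "dense_leaf S = 2 ^ card S"

definition leaf_cost :: "circuit \<Rightarrow> nat set \<Rightarrow> real" where
  "leaf_cost C S = min (frame_leaf C S) (dense_leaf S)"

definition dense_cost :: "nat \<Rightarrow> real" where
  "dense_cost n = 2 ^ n"

definition beneficial_in_time :: "nat \<Rightarrow> real \<Rightarrow> bool" where
  "beneficial_in_time n cost \<longleftrightarrow> cost < dense_cost n"

end

theory Submission
  imports Defs
begin

text \<open>Each of the \<open>2 ^ d\<close> branches pays the same two leaf costs, so by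
  \<open>cut_cost_eq\<close> the cut costs \<open>2 ^ d * s\<close> with \<open>s\<close> the sum of
  the leaf costs. As \<open>s\<close> is positive and \<open>log 2\<close> is strictly increasing,
  \<open>2 ^ d * s < 2 ^ n\<close> means \<open>d + log 2 s < n\<close>; this is
  \<open>power_mult_less_power_iff\<close>, and every claim is an instance of it for a suitable
  \<open>s\<close>.\<close>

lemma power_mult_less_power_iff:
  fixes s :: real
  assumes "s > 0"
  shows "2 ^ d * s < 2 ^ n \<longleftrightarrow> real d < real n - log 2 s"
proof -
  have "2 ^ d * s < 2 ^ n \<longleftrightarrow> log 2 (2 ^ d * s) < log 2 (2 ^ n)"
    using assms by (subst log_less_cancel_iff) simp_all
  also have "\<dots> \<longleftrightarrow> real d < real n - log 2 s"
    using assms by (simp add: log_mult log_nat_power less_diff_eq)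
  finally show ?thesis .
qed

theorem proposition4:
  fixes n nA nB TA TB d :: nat and C :: circuit and A B :: "nat set"
  assumes "clifford_T_circuit n C"
    and "bipartition n A B"
    and "cross_cuts_rank_two C A B"
    and "nA = card A" and "nB = card B"
    and "TA = local_T_count C A" and "TB = local_T_count C B"
    and "d = card (cross_cut_positions C A B)"
  shows
    "(beneficial_in_time n (cut_cost C A B (leaf_cost C A) (leaf_cost C B)) \<longleftrightarrow>
        real d < real n / 2
                 - log 2 (min (2 ^ TA) (2 ^ nA) + min (2 ^ TB) (2 ^ nB))
                 + 1 / 2 * log 2 (2 ^ n))
     \<and> (real nA = real n / 2 \<and> real nB = real n / 2 \<longrightarrow>
          \<comment> \<open>up to the constant factor 2 contributed by the two equal leaf costs\<close>
          (beneficial_in_time n (cut_cost C A B (dense_leaf A) (dense_leaf B) / 2) \<longleftrightarrow>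
             real d < real n / 2)
          \<comment> \<open>with that factor kept\<close>
        \<and> (beneficial_in_time n (cut_cost C A B (dense_leaf A) (dense_leaf B)) \<longleftrightarrow>
             real d < real n / 2 - 1))"
proof (intro conjI impI)
  show "beneficial_in_time n (cut_cost C A B (leaf_cost C A) (leaf_cost C B)) \<longleftrightarrow>
      real d < real n / 2 - log 2 (min (2 ^ TA) (2 ^ nA) + min (2 ^ TB) (2 ^ nB))
               + 1 / 2 * log 2 (2 ^ n)"
  proof -
    have "min (2 ^ TA) (2 ^ nA) + min (2 ^ TB) (2 ^ nB) > (0::real)"
      by (simp add: add_pos_pos)
    \<comment> \<open>The term \<open>1 / 2 * log 2 (2 ^ n)\<close> equals \<open>n / 2\<close>, so
      the two halves in the stated bound add up to \<open>n\<close>.\<close>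
    from power_mult_less_power_iff [OF this, of d n] show ?thesis
      by (simp add: beneficial_in_time_def cut_cost_eq leaf_cost_def frame_leaf_def
          dense_leaf_def dense_cost_def assms(4-8) log_nat_power)
  qed
next
  assume bal: "real nA = real n / 2 \<and> real nB = real n / 2"
  then have eq: "nB = nA" and n: "real n = 2 * real nA"
    by simp_all
  \<comment> \<open>The two leaves are equal, so their sum doubles one of them: this is the
    \<open>+ 1\<close> in the exponent.\<close>
  have cost: "cut_cost C A B (dense_leaf A) (dense_leaf B) = 2 ^ d * 2 ^ (nA + 1)"
    using eq by (simp add: cut_cost_eq dense_leaf_def flip: assms(4,5,8))
  show "beneficial_in_time n (cut_cost C A B (dense_leaf A) (dense_leaf B) / 2) \<longleftrightarrow>
      real d < real n / 2"
    \<comment> \<open>Halving the cost leaves \<open>s = 2 ^ nA\<close>, with threshold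
      \<open>n - nA = n / 2\<close>.\<close>
    using power_mult_less_power_iff [of "2 ^ nA" d n] n
    by (simp add: beneficial_in_time_def dense_cost_def cost log_nat_power)
  show "beneficial_in_time n (cut_cost C A B (dense_leaf A) (dense_leaf B)) \<longleftrightarrow>
      real d < real n / 2 - 1"
    \<comment> \<open>The full sum lowers the threshold by one. Without \<open>power_Suc\<close> the
      power stays whole, and its logarithm is read off as \<open>nA + 1\<close>.\<close>
    using power_mult_less_power_iff [of "2 ^ (nA + 1)" d n] n
    by (simp add: beneficial_in_time_def dense_cost_def cost log_nat_power algebra_simps
        del: power_Suc)
qed

end
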